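(* Let $T$ be a continuous bundle random dynamical system over $(\Omega,\mathcal{F},\mathbb{P},\vartheta)$ with bundle $\mathcal{E}\subset\Omega\times X$. For every integer $n\ge1$ and every finite open cover $\alpha$ of $X$, the function $\omega\mapsto\mathcal{D}\big(\alpha_0^{n-1}(\omega|\mathcal{E})\big)$ is measurable on $(\Omega,\mathcal{F})$.
   Context: Setting. $(\Omega,\mathcal{F},\mathbb{P})$ is a complete probability space, $\vartheta:\Omega\to\Omega$ is a $\mathbb{P}$-preserving transformation, $(X,d)$ is a compact metric space with Borel $\sigma$-algebra $\mathcal{B}$. $\mathcal{E}\subset\Omega\times X$ is measurable with respect to $\mathcal{F}\otimes\mathcal{B}$ and its fibers $\mathcal{E}_\omega=\{x\in X:(\omega,x)\in\mathcal{E}\}$ are nonempty compact subsets of $X$. A continuous bundle random dynamical system (RDS) $T$ over $(\Omega,\mathcal{F},\mathbb{P},\vartheta)$ is given by maps $T_\omega:\mathcal{E}_\omega\to\mathcal{E}_{\vartheta\omega}$ such that $(\omega,x)\mapsto T_\omega x$ is measurable and $x\mapsto T_\omega x$ is continuous for $\mathbb{P}$-almost all $\omega$. Put $T^n_\omega=T_{\vartheta^{n-1}\omega}\circ\cdots\circ T_{\vartheta\omega}\circ T_\omega$ for $n\ge1$ and $T^0_\omega=\mathrm{id}$. Covers. For a finite open cover $\alpha$ of a compact set $K\subset X$, $\mathrm{ord}(\alpha)=-1+\sup_{x\in K}\sum_{U\in\alpha}1_U(x)$ and $\mathcal{D}(\alpha)=\min_{\beta\succ\alpha}\mathrm{ord}(\beta)$,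 where $\beta$ runs over all finite open covers of $K$ refining $\alpha$ (every member of $\beta$ is contained in a member of $\alpha$). For a finite open cover $\alpha$ of $X$, $\alpha(\omega|\mathcal{E})=\{A\cap\mathcal{E}_\omega:A\in\alpha\}$ is an open cover of $\mathcal{E}_\omega$, and $\alpha_0^{n-1}(\omega|\mathcal{E})=\bigvee_{i=0}^{n-1}(T^i_\omega)^{-1}\alpha(\vartheta^i\omega|\mathcal{E})$ is the open cover of $\mathcal{E}_\omega$ by all sets $\bigcap_{i=0}^{n-1}(T^i_\omega)^{-1}(A_i\cap\mathcal{E}_{\vartheta^i\omega})$ with $A_i\in\alpha$ (defined for those $\omega$, $\mathbb{P}$-almost all, for which the maps $T^i_\omega$ are continuous). *)

theory Defs
  imports "HOL-Probability.Probability"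
begin

text \<open>
  Open covers of \<open>K\<close> consist of relatively open subsets of \<open>K\<close>, so that the traces
  \<open>A \<inter> K\<close> of open sets \<open>A\<close> of the ambient space form an open cover of \<open>K\<close>. For
  \<open>K = UNIV\<close> these are the usual open covers of the whole space.
\<close>

definition finite_open_cover :: "'a::topological_space set \<Rightarrow> 'a set set \<Rightarrow> bool" where
  "finite_open_cover K \<alpha> \<longleftrightarrow>
     finite \<alpha> \<and> (\<forall>U\<in>\<alpha>. openin (top_of_set K) U) \<and> \<Union>\<alpha> = K"

definition refines :: "'a set set \<Rightarrow> 'a set set \<Rightarrow> bool" (infix \<open>refines\<close> 50) where
  "\<beta> refines \<alpha> \<longleftrightarrow> (\<forall>V\<in>\<beta>. \<exists>U\<in>\<alpha>. V \<subseteq> U)"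

definition cover_ord :: "'a set \<Rightarrow> 'a set set \<Rightarrow> int" where
  "cover_ord K \<alpha> = - 1 + (SUP x\<in>K. \<Sum>U\<in>\<alpha>. indicator U x)"

text \<open>
  The minimum is taken in the integers; it exists for every finite open cover of a nonempty
  \<open>K\<close>, see \<open>cover_dim_attained\<close> and \<open>cover_dim_le\<close> below.
\<close>

definition cover_dim :: "'a::topological_space set \<Rightarrow> 'a set set \<Rightarrow> int" (\<open>\<D>\<close>) where
  "\<D> K \<alpha> = (LEAST d. \<exists>\<beta>. finite_open_cover K \<beta> \<and> \<beta> refines \<alpha> \<and> d = cover_ord K \<beta>)"

definition fiber :: "('w \<times> 'x) set \<Rightarrow> 'w \<Rightarrow> 'x set" where
  "fiber E \<omega> = {x. (\<omega>, x) \<in> E}"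

text \<open>
  The compact metric space \<open>X\<close> is a whole type. The fiber map over \<open>\<omega>\<close> is
  \<open>T \<omega>\<close>; its values outside \<open>fiber E \<omega>\<close> are irrelevant. The base map \<open>\<theta>\<close> preserves
  the measure and need not be invertible.
\<close>

locale continuous_bundle_rds = prob_space M + complete_measure M
  for M :: "'w measure" +
  fixes \<theta> :: "'w \<Rightarrow> 'w"
    and E :: "('w \<times> 'x::metric_space) set"
    and T :: "'w \<Rightarrow> 'x \<Rightarrow> 'x"
  assumes compact_X: "compact (UNIV :: 'x set)"
    and base_measurable: "\<theta> \<in> M \<rightarrow>\<^sub>M M"
    and base_preserving: "distr M M \<theta> = M"
    and bundle_measurable: "E \<in> sets (M \<Otimes>\<^sub>M borel)"
    and fiber_nonempty: "\<And>\<omega>. \<omega> \<in> space M \<Longrightarrow> fiber E \<omega> \<noteq> {}"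
    and fiber_compact: "\<And>\<omega>. \<omega> \<in> space M \<Longrightarrow> compact (fiber E \<omega>)"
    and map_fiber: "\<And>\<omega>. \<omega> \<in> space M \<Longrightarrow> T \<omega> ` fiber E \<omega> \<subseteq> fiber E (\<theta> \<omega>)"
    and map_measurable: "(\<lambda>(\<omega>, x). T \<omega> x) \<in> restrict_space (M \<Otimes>\<^sub>M borel) E \<rightarrow>\<^sub>M borel"
    and map_continuous: "AE \<omega> in M. continuous_on (fiber E \<omega>) (T \<omega>)"

primrec iterate :: "('w \<Rightarrow> 'w) \<Rightarrow> ('w \<Rightarrow> 'x \<Rightarrow> 'x) \<Rightarrow> nat \<Rightarrow> 'w \<Rightarrow> 'x \<Rightarrow> 'x" where
  "iterate \<theta> T 0 \<omega> = id"
| "iterate \<theta> T (Suc n) \<omega> = T ((\<theta> ^^ n) \<omega>) \<circ> iterate \<theta> T n \<omega>"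

text \<open>
  \<open>join_cover \<theta> E T \<alpha> n \<omega>\<close> is the cover \<open>\<alpha>\<^sub>0\<^sup>n\<^sup>-\<^sup>1(\<omega>|\<E>)\<close> of \<open>fiber E \<omega>\<close>, for \<open>n \<ge> 1\<close>.
  Preimages are taken within \<open>fiber E \<omega>\<close>, the domain of the iterates over \<open>\<omega>\<close>.
\<close>

definition join_cover ::
  "('w \<Rightarrow> 'w) \<Rightarrow> ('w \<times> 'x) set \<Rightarrow> ('w \<Rightarrow> 'x \<Rightarrow> 'x) \<Rightarrow> 'x set set \<Rightarrow> nat \<Rightarrow> 'w \<Rightarrow> 'x set set" where
  "join_cover \<theta> E T \<alpha> n \<omega> =
     {(\<Inter>i<n. {x \<in> fiber E \<omega>. iterate \<theta> T i \<omega> x \<in> A i \<inter> fiber E ((\<theta> ^^ i) \<omega>)}) |A.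
        \<forall>i<n. A i \<in> \<alpha>}"

lemma cover_ord_ge:
  assumes "finite \<beta>" and "K \<noteq> {}"
  shows "- 1 \<le> cover_ord K \<beta>"
proof -
  obtain x where x: "x \<in> K" using assms by auto
  have bd: "bdd_above ((\<lambda>x. \<Sum>U\<in>\<beta>. indicator U x :: int) ` K)"
    by (rule bdd_aboveI2[where M = "\<Sum>U\<in>\<beta>. 1"]) (intro sum_mono indicator_le_1)
  have "(0::int) \<le> (\<Sum>U\<in>\<beta>. indicator U x)" by (intro sum_nonneg) auto
  also have "\<dots> \<le> (SUP x\<in>K. \<Sum>U\<in>\<beta>. indicator U x)" using bd x by (rule cSUP_upper2) simp
  finally show ?thesis by (simp add: cover_ord_def)
qed

lemma int_Least_props:
  fixes P :: "int \<Rightarrow> bool"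
  assumes "P a" and lb: "\<And>d. P d \<Longrightarrow> - 1 \<le> d"
  shows "P (Least P)" and "\<And>d. P d \<Longrightarrow> Least P \<le> d"
proof -
  define m where "m = (LEAST k::nat. P (int k - 1))"
  have "P (int (nat (a + 1)) - 1)" using assms(1) lb[OF assms(1)] by simp
  then have Pm: "P (int m - 1)" unfolding m_def by (rule LeastI)
  have le: "int m - 1 \<le> d" if "P d" for d
  proof -
    have "P (int (nat (d + 1)) - 1)" using that lb[OF that] by simp
    then have "m \<le> nat (d + 1)" unfolding m_def by (rule Least_le)
    then show ?thesis using lb[OF that] by linarith
  qed
  have eq: "Least P = int m - 1" using Pm le by (rule Least_equality)
  show "P (Least P)" using Pm eq by simp
  show "\<And>d. P d \<Longrightarrow> Least P \<le> d" using le eq by simp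
qed

lemma cover_dim_attained:
  assumes "finite_open_cover K \<alpha>" and "K \<noteq> {}"
  shows "\<exists>\<beta>. finite_open_cover K \<beta> \<and> \<beta> refines \<alpha> \<and> \<D> K \<alpha> = cover_ord K \<beta>"
proof -
  let ?P = "\<lambda>d. \<exists>\<beta>. finite_open_cover K \<beta> \<and> \<beta> refines \<alpha> \<and> d = cover_ord K \<beta>"
  have "\<alpha> refines \<alpha>" by (auto simp: refines_def)
  then have "?P (cover_ord K \<alpha>)" using assms(1) by blast
  then have "?P (Least ?P)"
    by (rule int_Least_props(1)[of ?P]) (use assms(2) cover_ord_ge finite_open_cover_def in blast)
  then show ?thesis by (simp only: cover_dim_def)
qed

lemma cover_dim_le:
  assumes "finite_open_cover K \<beta>" and "\<beta> refines \<alpha>" and "K \<noteq> {}"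
  shows "\<D> K \<alpha> \<le> cover_ord K \<beta>"
proof -
  let ?P = "\<lambda>d. \<exists>\<beta>. finite_open_cover K \<beta> \<and> \<beta> refines \<alpha> \<and> d = cover_ord K \<beta>"
  have P: "?P (cover_ord K \<beta>)" using assms(1,2) by blast
  have "- 1 \<le> d" if "?P d" for d
    using that assms(3) cover_ord_ge finite_open_cover_def by blast
  from int_Least_props(2)[of ?P, OF P this P] show ?thesis by (simp only: cover_dim_def)
qed

context continuous_bundle_rds
begin

lemma base_iterate: "\<omega> \<in> space M \<Longrightarrow> (\<theta> ^^ n) \<omega> \<in> space M"
  by (induction n) (use base_measurable in \<open>auto simp: measurable_space\<close>)

lemma iterate_fiber:
  assumes "\<omega> \<in> space M" and "x \<in> fiber E \<omega>"
  shows "iterate \<theta> T n \<omega> x \<in> fiber E ((\<theta> ^^ n) \<omega>)"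
  by (induction n) (use assms map_fiber base_iterate in \<open>auto simp: image_subset_iff\<close>)

lemma AE_base_iterate:
  assumes "AE \<omega> in M. P \<omega>"
  shows "AE \<omega> in M. P ((\<theta> ^^ n) \<omega>)"
proof (induction n)
  case (Suc n)
  have "AE \<omega> in distr M M \<theta>. P ((\<theta> ^^ n) \<omega>)" unfolding base_preserving by (rule Suc)
  from AE_distrD[OF base_measurable this] show ?case by (simp add: funpow_swap1)
qed (use assms in simp)

text \<open>
  The iterates over \<open>\<omega>\<close> are continuous for almost all \<open>\<omega>\<close>, and then \<open>join_cover\<close> is a
  finite open cover of the fiber. Since \<open>M\<close> is complete, the values of a function at the
  remaining \<open>\<omega>\<close> do not affect its measurability.
\<close>

lemma AE_continuous_iterate:
  "AE \<omega> in M. \<forall>i. continuous_on (fiber E \<omega>) (iterate \<theta> T i \<omega>)"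
proof -
  have "AE \<omega> in M. \<forall>i. continuous_on (fiber E ((\<theta> ^^ i) \<omega>)) (T ((\<theta> ^^ i) \<omega>))"
    using AE_base_iterate[OF map_continuous] by (simp add: AE_all_countable)
  with AE_space show ?thesis
  proof eventually_elim
    case (elim \<omega>)
    show ?case
    proof
      fix i
      show "continuous_on (fiber E \<omega>) (iterate \<theta> T i \<omega>)"
      proof (induction i)
        case (Suc i)
        have "iterate \<theta> T i \<omega> ` fiber E \<omega> \<subseteq> fiber E ((\<theta> ^^ i) \<omega>)"
          using iterate_fiber elim(1) by blast
        then have "continuous_on (iterate \<theta> T i \<omega> ` fiber E \<omega>) (T ((\<theta> ^^ i) \<omega>))"
          using elim(2) continuous_on_subset by blast
        with Suc show ?case unfolding iterate.simps by (rule continuous_on_compose)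
      qed (simp add: id_def)
    qed
  qed
qed

lemma finite_open_cover_join_cover:
  assumes \<alpha>: "finite_open_cover UNIV \<alpha>" and n: "n \<ge> 1" and \<omega>: "\<omega> \<in> space M"
    and cont: "\<And>i. i < n \<Longrightarrow> continuous_on (fiber E \<omega>) (iterate \<theta> T i \<omega>)"
  shows "finite_open_cover (fiber E \<omega>) (join_cover \<theta> E T \<alpha> n \<omega>)"
proof -
  define F where "F A = (\<Inter>i<n. {x \<in> fiber E \<omega>. iterate \<theta> T i \<omega> x \<in> A i \<inter> fiber E ((\<theta> ^^ i) \<omega>)})"
    for A
  have F_eq: "F A = (\<Inter>i<n. fiber E \<omega> \<inter> iterate \<theta> T i \<omega> -` A i)" for A
    using iterate_fiber[OF \<omega>] by (auto simp: F_def)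
  have J: "join_cover \<theta> E T \<alpha> n \<omega> = {F A |A. \<forall>i<n. A i \<in> \<alpha>}"
    by (simp add: join_cover_def F_def)
  have "join_cover \<theta> E T \<alpha> n \<omega> \<subseteq> F ` (PiE {..<n} (\<lambda>_. \<alpha>))"
  proof
    fix U assume "U \<in> join_cover \<theta> E T \<alpha> n \<omega>"
    then obtain A where A: "U = F A" "\<forall>i<n. A i \<in> \<alpha>" by (auto simp: J)
    have "F A = F (restrict A {..<n})" by (simp add: F_def)
    with A show "U \<in> F ` (PiE {..<n} (\<lambda>_. \<alpha>))" by auto
  qed
  moreover have "finite (PiE {..<n} (\<lambda>_. \<alpha>))"
    using \<alpha> by (intro finite_PiE) (auto simp: finite_open_cover_def)
  ultimately have "finite (join_cover \<theta> E T \<alpha> n \<omega>)" by (meson finite_imageI finite_subset)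
  moreover have "openin (top_of_set (fiber E \<omega>)) (F A)" if "\<forall>i<n. A i \<in> \<alpha>" for A
    unfolding F_eq
  proof (rule openin_INT2)
    fix i assume "i \<in> {..<n}"
    then show "openin (top_of_set (fiber E \<omega>)) (fiber E \<omega> \<inter> iterate \<theta> T i \<omega> -` A i)"
      using that \<alpha> cont by (intro continuous_openin_preimage_gen) (auto simp: finite_open_cover_def)
  qed (use n in \<open>auto simp: lessThan_empty_iff\<close>)
  moreover have "\<Union>(join_cover \<theta> E T \<alpha> n \<omega>) = fiber E \<omega>"
  proof
    show "\<Union>(join_cover \<theta> E T \<alpha> n \<omega>) \<subseteq> fiber E \<omega>"
    proof -
      have "F A \<subseteq> fiber E \<omega>" for A using n by (auto simp: F_eq lessThan_empty_iff)
      then show ?thesis by (auto simp: J)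
    qed
    show "fiber E \<omega> \<subseteq> \<Union>(join_cover \<theta> E T \<alpha> n \<omega>)"
    proof
      fix x assume x: "x \<in> fiber E \<omega>"
      have "\<exists>U\<in>\<alpha>. iterate \<theta> T i \<omega> x \<in> U" for i
        using \<alpha> by (auto simp: finite_open_cover_def)
      then obtain A where A: "\<And>i. A i \<in> \<alpha> \<and> iterate \<theta> T i \<omega> x \<in> A i" by metis
      with x have "x \<in> F A" unfolding F_eq by blast
      with A show "x \<in> \<Union>(join_cover \<theta> E T \<alpha> n \<omega>)" unfolding J by blast
    qed
  qed
  ultimately show ?thesis by (auto simp: finite_open_cover_def J)
qed

end

end

theory Submission
  imports Defs
begin

text \<open>
  Write \<open>K\<close> for the fiber over \<open>\<omega>\<close> and \<open>\<gamma>\<close> for the joined cover of \<open>K\<close>. Fix a countable basis of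
  \<open>X\<close> and close it under finite unions. Since \<open>K\<close> is compact, every finite open cover of \<open>K\<close> can be
  shrunk to the trace of a finite family of such sets, so \<open>\<D> K \<gamma> \<le> d\<close> iff one of countably many
  finite families \<open>\<U>\<close> covers \<open>K\<close>, refines \<open>\<gamma>\<close> on \<open>K\<close>, and covers no point of \<open>K\<close> more than
  \<open>d + 1\<close> times. For fixed \<open>\<U>\<close> each of these conditions says that some measurable subset of \<open>\<E>\<close>
  has no point over \<open>\<omega>\<close>, so it is measurable in \<open>\<omega>\<close> by the projection theorem.

  The projection theorem holds because measurable subsets of \<open>\<Omega> \<times> X\<close> arise by the Souslin
  operation from rectangles \<open>A \<times> C\<close> with \<open>C\<close> closed. By compactness of \<open>X\<close> the projection commutes
  with this operation, and a complete finite measure space is closed under it.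
\<close>

section \<open>The Souslin operation\<close>

text \<open>Encodes a scheme indexed by finite sequences: \<open>L n f\<close> stands for the set
  attached to the first \<open>n\<close> values of \<open>f\<close>. In particular, depth 0 carries
  a single set, the same for all branches.\<close>

definition prefix_determined :: "(nat \<Rightarrow> (nat \<Rightarrow> nat) \<Rightarrow> 'b) \<Rightarrow> bool" where
  "prefix_determined L \<longleftrightarrow> (\<forall>n f g. (\<forall>i<n. f i = g i) \<longrightarrow> L n f = L n g)"

definition souslin :: "'a set set \<Rightarrow> 'a set set" where
  "souslin P = {(\<Union>f. \<Inter>n. L n f) |L. (\<forall>n f. L n f \<in> P) \<and> prefix_determined L}"

lemma prefix_determinedD: "prefix_determined L \<Longrightarrow> (\<And>i. i < n \<Longrightarrow> f i = g i) \<Longrightarrow> L n f = L n g"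
  by (auto simp: prefix_determined_def)

lemma souslinI:
  assumes "\<And>n f. L n f \<in> P" and "prefix_determined L" and "S = (\<Union>f. \<Inter>n. L n f)"
  shows "S \<in> souslin P"
  using assms unfolding souslin_def by blast

lemma souslin_basic: "A \<in> P \<Longrightarrow> A \<in> souslin P"
  by (rule souslinI[of "\<lambda>_ _. A"]) (auto simp: prefix_determined_def)

section \<open>Closure of Souslin families under countable unions and intersections\<close>

lemma souslin_UN:
  fixes S :: "nat \<Rightarrow> 'a set"
  assumes S: "\<And>i. S i \<in> souslin P" and top: "W \<in> P" "\<And>i. S i \<subseteq> W"
  shows "(\<Union>i. S i) \<in> souslin P"
proof -
  have "\<exists>L. (\<forall>n f. L n f \<in> P) \<and> prefix_determined L \<and> S i = (\<Union>f. \<Inter>n. L n f)" for i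
    using S[of i] by (auto simp: souslin_def)
  then obtain L where L: "\<And>i n f. L i n f \<in> P" "\<And>i. prefix_determined (L i)"
    "\<And>i. S i = (\<Union>f. \<Inter>n. L i n f)" by metis
  \<comment> \<open>The set at depth 0 must not depend on \<open>f 0\<close>, which is why \<open>W\<close> is needed.\<close>
  define L' where "L' n f = (case n of 0 \<Rightarrow> W | Suc m \<Rightarrow> L (f 0) m (\<lambda>k. f (Suc k)))" for n f
  show ?thesis
  proof (rule souslinI[of L'])
    show "L' n f \<in> P" for n f by (auto simp: L'_def L top split: nat.split)
    show "prefix_determined L'"
      unfolding prefix_determined_def
    proof (intro allI impI)
      fix n :: nat and f g :: "nat \<Rightarrow> nat" assume *: "\<forall>i<n. f i = g i"
      show "L' n f = L' n g"
      proof (cases n)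
        case (Suc m)
        then have "L (f 0) m (\<lambda>k. f (Suc k)) = L (f 0) m (\<lambda>k. g (Suc k))"
          using * by (intro prefix_determinedD[OF L(2)]) auto
        with Suc * show ?thesis by (simp add: L'_def)
      qed (simp add: L'_def)
    qed
    show "(\<Union>i. S i) = (\<Union>f. \<Inter>n. L' n f)"
    proof (intro subset_antisym subsetI)
      fix x assume "x \<in> (\<Union>i. S i)"
      then obtain i where i: "x \<in> S i" by auto
      then obtain f where f: "\<And>n. x \<in> L i n f" by (auto simp: L(3))
      \<comment> \<open>The head of a branch of \<open>L'\<close> selects the set
        \<open>S i\<close>; its tail is a branch of the scheme of \<open>S i\<close>.\<close>
      have "x \<in> L' n (case_nat i f)" for n
        using i f top by (auto simp: L'_def split: nat.split)
      then show "x \<in> (\<Union>f. \<Inter>n. L' n f)" by blast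
    next
      fix x assume "x \<in> (\<Union>f. \<Inter>n. L' n f)"
      then obtain f where f: "\<And>n. x \<in> L' n f" by auto
      have "x \<in> L (f 0) n (\<lambda>k. f (Suc k))" for n
        using f[of "Suc n"] by (simp add: L'_def)
      then show "x \<in> (\<Union>i. S i)" by (auto simp: L(3))
    qed
  qed
qed

text \<open>Ensures that the first \<open>prod_encode (i, n)\<close> values of a branch include the
  first \<open>n\<close> values of its \<open>i\<close>-th row, as prefix determinacy in
  \<open>souslin_INT\<close> demands.\<close>

lemma prod_encode_strict_mono: "k < n \<Longrightarrow> prod_encode (i, k) < prod_encode (i, n)"
  by (induction n) (auto simp: prod_encode_def less_Suc_eq)

text \<open>A point of the intersection has one witnessing branch for each \<open>i\<close>. The
  pairing function packs this sequence of branches into a single branch, whose rows are the given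
  ones.\<close>

lemma souslin_INT:
  fixes S :: "nat \<Rightarrow> 'a set"
  assumes S: "\<And>i. S i \<in> souslin P"
  shows "(\<Inter>i. S i) \<in> souslin P"
proof -
  have "\<exists>L. (\<forall>n f. L n f \<in> P) \<and> prefix_determined L \<and> S i = (\<Union>f. \<Inter>n. L n f)" for i
    using S[of i] by (auto simp: souslin_def)
  then obtain L where L: "\<And>i n f. L i n f \<in> P" "\<And>i. prefix_determined (L i)"
    "\<And>i. S i = (\<Union>f. \<Inter>n. L i n f)" by metis
  define L' where "L' m f = (case prod_decode m of (i, n) \<Rightarrow> L i n (\<lambda>k. f (prod_encode (i, k))))" for m f
  have L'_enc: "L' (prod_encode (i, n)) f = L i n (\<lambda>k. f (prod_encode (i, k)))" for i n f
    by (simp add: L'_def)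
  show ?thesis
  proof (rule souslinI[of L'])
    show "L' n f \<in> P" for n f by (auto simp: L'_def L split: prod.split)
    show "prefix_determined L'"
      unfolding prefix_determined_def
    proof (intro allI impI)
      fix m :: nat and f g :: "nat \<Rightarrow> nat" assume *: "\<forall>i<m. f i = g i"
      obtain i n where m: "m = prod_encode (i, n)" by (metis prod_decode_inverse surj_pair)
      show "L' m f = L' m g"
        unfolding m L'_enc
        using * by (intro prefix_determinedD[OF L(2)]) (auto simp: m prod_encode_strict_mono)
    qed
    show "(\<Inter>i. S i) = (\<Union>f. \<Inter>n. L' n f)"
    proof (intro subset_antisym subsetI)
      fix x assume "x \<in> (\<Inter>i. S i)"
      then have "\<forall>i. \<exists>f. \<forall>n. x \<in> L i n f" by (auto simp: L(3))
      then obtain F where F: "\<And>i n. x \<in> L i n (F i)" by metis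
      define f where "f m = (case prod_decode m of (i, k) \<Rightarrow> F i k)" for m
      have "x \<in> L' m f" for m
        by (auto simp: L'_def f_def F split: prod.split)
      then show "x \<in> (\<Union>f. \<Inter>n. L' n f)" by blast
    next
      fix x assume "x \<in> (\<Union>f. \<Inter>n. L' n f)"
      then obtain f where f: "\<And>n. x \<in> L' n f" by auto
      have "x \<in> L i n (\<lambda>k. f (prod_encode (i, k)))" for i n
        using f[of "prod_encode (i, n)"] by (simp add: L'_enc)
      then show "x \<in> (\<Inter>i. S i)" by (auto simp: L(3))
    qed
  qed
qed

lemma souslin_Un:
  assumes "A \<in> souslin P" "B \<in> souslin P" "W \<in> P" "A \<subseteq> W" "B \<subseteq> W"
  shows "A \<union> B \<in> souslin P"
proof -
  have "(\<Union>i. if i = (0::nat) then A else B) \<in> souslin P"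
    using assms by (intro souslin_UN[where W=W]) auto
  also have "(\<Union>i. if i = (0::nat) then A else B) = A \<union> B"
    by (auto split: if_splits)
  finally show ?thesis .
qed

text \<open>\<open>souslin P\<close> need not be closed under complements, so the induction carries
  a set together with its complement. Closure under countable unions and intersections makes such
  sets a \<sigma>-algebra.\<close>

lemma sigma_sets_subset_souslin:
  assumes P: "P \<subseteq> Pow W" "W \<in> P" "{} \<in> P"
    and G: "G \<subseteq> Pow W" "\<And>A. A \<in> G \<Longrightarrow> A \<in> souslin P" "\<And>A. A \<in> G \<Longrightarrow> W - A \<in> souslin P"
  shows "sigma_sets W G \<subseteq> souslin P"
proof
  fix A assume "A \<in> sigma_sets W G"
  then have "A \<subseteq> W \<and> A \<in> souslin P \<and> W - A \<in> souslin P"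
  proof induction
    case (Basic a)
    then show ?case using G by auto
  next
    case Empty
    then show ?case using P by (auto intro: souslin_basic)
  next
    case (Compl a)
    then show ?case by (auto simp: double_diff)
  next
    case (Union a)
    have "(\<Union>i. a i) \<in> souslin P" using Union P by (intro souslin_UN[where W=W]) auto
    moreover have "(\<Inter>i. W - a i) \<in> souslin P" using Union by (intro souslin_INT) auto
    ultimately show ?case using Union by auto
  qed
  then show "A \<in> souslin P" by blast
qed

section \<open>Complete finite measure spaces are closed under the Souslin operation\<close>

lemma konig_bounded:
  fixes h :: "nat \<Rightarrow> nat \<Rightarrow> nat" and b :: "nat \<Rightarrow> nat"
  assumes "\<And>k i. i < k \<Longrightarrow> h k i \<le> b i"
  shows "\<exists>f. \<forall>n. \<exists>k\<ge>n. \<forall>i<n. h k i = f i"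
proof -
  \<comment> \<open>\<open>N (Suc j)\<close> thins \<open>N j\<close> to an infinite set of indices
    on which coordinate \<open>j\<close> is constant. The constants form the limit branch
    \<open>f\<close>.\<close>
  have "\<exists>N. \<forall>j. infinite (N j) \<and> N (Suc j) \<subseteq> N j \<and> (\<exists>v. \<forall>k\<in>N (Suc j). h k j = v)"
  proof (rule dependent_nat_choice, goal_cases)
    case 1
    show ?case by (rule exI[of _ UNIV]) auto
  next
    case (2 N j)
    \<comment> \<open>The bound on \<open>h k j\<close> is available only for \<open>k > j\<close>;
      discarding finitely many indices makes the pigeonhole principle applicable.\<close>
    have inf: "infinite (N \<inter> {j<..})"
      using 2 by (metis Compl_greaterThan finite_Diff2 finite_atMost Diff_Compl)
    have "finite ((\<lambda>k. h k j) ` (N \<inter> {j<..}))"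
      by (rule finite_subset[of _ "{..b j}"]) (use assms in auto)
    from pigeonhole_infinite[OF inf this] obtain k0 where
      k0: "infinite {k \<in> N \<inter> {j<..}. h k j = h k0 j}" by auto
    show ?case by (rule exI[of _ "{k \<in> N \<inter> {j<..}. h k j = h k0 j}"]) (use k0 in auto)
  qed
  then obtain N where N: "\<And>j. infinite (N j)" "\<And>j. N (Suc j) \<subseteq> N j"
    "\<forall>j. \<exists>v. \<forall>k\<in>N (Suc j). h k j = v" by metis
  from N(3) obtain f where f: "\<And>j k. k \<in> N (Suc j) \<Longrightarrow> h k j = f j" by metis
  have "antimono N" using N(2) by (auto simp: decseq_Suc_iff)
  then have sub: "N n \<subseteq> N (Suc i)" if "i < n" for i n
    using that by (auto simp: decseq_def)
  have "\<exists>k\<ge>n. \<forall>i<n. h k i = f i" for n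
  proof -
    obtain k where "k \<in> N n" "k \<ge> n" using N(1)[of n] by (meson infinite_nat_iff_unbounded_le)
    with sub f show ?thesis by blast
  qed
  then show ?thesis by blast
qed

text \<open>
  Bound the branches one coordinate at a time by \<open>b\<close>, losing no outer measure below \<open>c\<close>. The
  branches below \<open>b\<close> form a finitely branching tree, so \<open>konig_bounded\<close> puts the intersection of the
  finite stages into \<open>S\<close>.
\<close>

lemma (in finite_measure) souslin_inner_approx:
  assumes B: "\<And>n f. B n f \<in> sets M" and det: "prefix_determined B"
    and S: "S = (\<Union>f. \<Inter>n. B n f)" and c: "c < outer_measure_of M S"
  shows "\<exists>L\<in>sets M. L \<subseteq> S \<and> c \<le> emeasure M L"
proof -
  let ?J = "\<lambda>G. \<Union>f\<in>G. \<Inter>n. B n f"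
  have Jsp: "?J G \<subseteq> space M" for G using B[THEN sets.sets_into_space] by blast
  have "\<exists>G. \<forall>k. (c < outer_measure_of M (?J (G k)) \<and> (k = 0 \<longrightarrow> G k = UNIV)) \<and>
    (\<exists>m. G (Suc k) = G k \<inter> {f. f k \<le> m})"
  proof (rule dependent_nat_choice, goal_cases)
    case 1
    show ?case using c S by auto
  next
    case (2 G k)
    have "(SUP m. outer_measure_of M (?J (G \<inter> {f. f k \<le> m}))) =
      outer_measure_of M (\<Union>m. ?J (G \<inter> {f. f k \<le> m}))"
      by (intro SUP_outer_measure_of_incseq Jsp) (fastforce simp: incseq_def)
    also have "(\<Union>m. ?J (G \<inter> {f. f k \<le> m})) = ?J G" by auto
    finally have "c < (SUP m. outer_measure_of M (?J (G \<inter> {f. f k \<le> m})))" using 2 by simp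
    then obtain m where "c < outer_measure_of M (?J (G \<inter> {f. f k \<le> m}))"
      by (auto simp: less_SUP_iff)
    then show ?case by (intro exI[of _ "G \<inter> {f. f k \<le> m}"]) auto
  qed
  then obtain G where G: "\<And>k. c < outer_measure_of M (?J (G k))" "G 0 = UNIV"
    "\<forall>k. \<exists>m. G (Suc k) = G k \<inter> {f. f k \<le> m}" by metis
  from G(3) obtain b where b: "\<And>k. G (Suc k) = G k \<inter> {f. f k \<le> b k}" by metis
  have G_eq: "G k = {f. \<forall>i<k. f i \<le> b i}" for k
    by (induction k) (auto simp: G(2) b less_Suc_eq)
  define H where "H k = (\<Pi>\<^sub>E i\<in>{..<k}. {..b i})" for k
  \<comment> \<open>A measurable set containing \<open>?J (G k)\<close>: stages up to
    \<open>k\<close> see only the first \<open>k\<close> coordinates of a branch, so finitely many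
    truncated branches below \<open>b\<close> suffice.\<close>
  define N where "N k = (\<Union>f\<in>H k. \<Inter>n\<in>{..k}. B n f)" for k
  have finH: "finite (H k)" for k by (auto simp: H_def intro!: finite_PiE)
  have N_sets[measurable]: "N k \<in> sets M" for k
    unfolding N_def using finH B by (intro sets.finite_UN sets.finite_INT) auto
  have restr: "B n (restrict f {..<k}) = B n f" if "n \<le> k" for n k f
    using that by (intro prefix_determinedD[OF det]) auto
  have JN: "?J (G k) \<subseteq> N k" for k
  proof
    fix x assume "x \<in> ?J (G k)"
    then obtain f where f: "f \<in> G k" "\<And>n. x \<in> B n f" by auto
    have "restrict f {..<k} \<in> H k" using f(1) by (auto simp: H_def G_eq)
    moreover have "x \<in> (\<Inter>n\<in>{..k}. B n (restrict f {..<k}))" using f(2) by (auto simp: restr)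
    ultimately show "x \<in> N k" unfolding N_def by blast
  qed
  have "decseq N"
  proof (rule decseq_SucI)
    fix k
    show "N (Suc k) \<subseteq> N k"
    proof
      fix x assume "x \<in> N (Suc k)"
      then obtain f where f: "f \<in> H (Suc k)" "\<And>n. n \<le> Suc k \<Longrightarrow> x \<in> B n f" by (auto simp: N_def)
      have "restrict f {..<k} \<in> H k" using f(1) by (simp add: H_def PiE_iff)
      moreover have "x \<in> (\<Inter>n\<in>{..k}. B n (restrict f {..<k}))" using f(2) by (auto simp: restr)
      ultimately show "x \<in> N k" unfolding N_def by blast
    qed
  qed
  have cN: "c \<le> emeasure M (N k)" for k
  proof -
    have "c < outer_measure_of M (?J (G k))" by (rule G)
    also have "\<dots> \<le> outer_measure_of M (N k)" by (intro outer_measure_of_mono JN)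
    finally show ?thesis by simp
  qed
  have "c \<le> (INF k. emeasure M (N k))" by (intro INF_greatest cN)
  also have "\<dots> = emeasure M (\<Inter>k. N k)"
    using \<open>decseq N\<close> by (intro INF_emeasure_decseq) auto
  finally have "c \<le> emeasure M (\<Inter>k. N k)" .
  moreover have "(\<Inter>k. N k) \<subseteq> S"
  proof
    fix x assume "x \<in> (\<Inter>k. N k)"
    then have "x \<in> N k" for k by blast
    then have "\<forall>k. \<exists>f. f \<in> H k \<and> (\<forall>n\<le>k. x \<in> B n f)"
      unfolding N_def by blast
    then obtain h where h: "\<And>k. h k \<in> H k" "\<And>k n. n \<le> k \<Longrightarrow> x \<in> B n (h k)" by metis
    have "h k i \<le> b i" if "i < k" for k i
      using h(1)[of k] that by (auto simp: H_def PiE_iff)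
    from konig_bounded[of h b, OF this]
    obtain f where f: "\<And>n. \<exists>k\<ge>n. \<forall>i<n. h k i = f i" by blast
    have "x \<in> B n f" for n
    proof -
      obtain k where k: "k \<ge> n" "\<forall>i<n. h k i = f i" using f by blast
      then have "B n (h k) = B n f" by (intro prefix_determinedD[OF det]) auto
      with h(2)[OF k(1)] show ?thesis by simp
    qed
    then show "x \<in> S" unfolding S by blast
  qed
  ultimately show ?thesis by (intro bexI[of _ "\<Inter>k. N k"]) auto
qed

text \<open>Isolates what the projection theorem uses, so that \<open>continuous_bundle_rds\<close>
  receives it as a sublocale.\<close>

locale complete_finite_measure = finite_measure M + complete_measure M for M :: "'w measure"

text \<open>A measurable hull \<open>U\<close> bounds \<open>S\<close> from outside with the same
  outer measure, and \<open>souslin_inner_approx\<close> gives measurable subsets of almost that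
  measure. By completeness, a set squeezed in this way is measurable.\<close>

lemma (in complete_finite_measure) souslin_sets: "souslin (sets M) \<subseteq> sets M"
proof
  fix S assume "S \<in> souslin (sets M)"
  then obtain B where B: "\<And>n f. B n f \<in> sets M" "prefix_determined B" "S = (\<Union>f. \<Inter>n. B n f)"
    unfolding souslin_def by blast
  have "S \<subseteq> space M" unfolding B(3) using sets.sets_into_space[OF B(1)[of 0]] by blast
  then obtain U where U: "U \<in> sets M" "S \<subseteq> U" "outer_measure_of M S = emeasure M U"
    using outer_measure_of_attain[of S M] by auto
  have "S \<in> fmeasurable M"
    unfolding fmeasurable_inner_outer
  proof (intro allI impI)
    fix e :: real assume e: "e > 0"
    have "\<exists>L\<in>sets M. L \<subseteq> S \<and> measure M U - e / 2 \<le> measure M L"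
    \<comment> \<open>The inner approximation needs a bound strictly below the outer measure, and
      none exists when that is 0. The empty set then serves.\<close>
    proof (cases "measure M U = 0")
      case True
      with e show ?thesis by (intro bexI[of _ "{}"]) auto
    next
      case False
      then have "ennreal (measure M U - e / 2) < outer_measure_of M S"
        using e U by (simp add: emeasure_eq_measure ennreal_lessI zero_less_measure_iff)
      from souslin_inner_approx[OF B this] show ?thesis
        by (auto simp: emeasure_eq_measure)
    qed
    then obtain L where L: "L \<in> sets M" "L \<subseteq> S" "measure M U - e / 2 \<le> measure M L" by blast
    moreover have "measure M L \<le> measure M U"
      using L U by (intro finite_measure_mono) auto
    ultimately show "\<exists>T\<in>fmeasurable M. \<exists>U\<in>fmeasurable M. T \<subseteq> S \<and> S \<subseteq> U \<and> \<bar>measure M T - measure M U\<bar> < e"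
      using U e by (intro bexI[of _ L] bexI[of _ U]) (auto simp: fmeasurable_eq_sets)
  qed
  then show "S \<in> sets M" by simp
qed

section \<open>Measurable projection\<close>

lemma compact_UNIV_decseq_INT_nonempty:
  fixes D :: "nat \<Rightarrow> 'x::topological_space set"
  assumes "compact (UNIV :: 'x set)" and "\<And>n. closed (D n)"
    and ne: "\<And>n. D n \<noteq> {}" and dec: "decseq D"
  shows "(\<Inter>n. D n) \<noteq> {}"
proof -
  have "UNIV \<inter> (\<Inter>n\<in>UNIV. D n) \<noteq> {}"
  proof (rule compact_imp_fip_image[OF assms(1)])
    fix I :: "nat set" assume I: "finite I"
    show "UNIV \<inter> (\<Inter>i\<in>I. D i) \<noteq> {}"
    proof (cases "I = {}")
      case False
      have "D (Max I) \<subseteq> D i" if "i \<in> I" for i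
        using dec I that by (simp add: decseq_def)
      with ne[of "Max I"] show ?thesis by blast
    qed auto
  qed (use assms in auto)
  then show ?thesis by simp
qed

text \<open>The closed sets are those at distance at least \<open>1 / (n + 1)\<close> from
  \<open>C\<close>. This is needed to write the complement of a closed rectangle as a countable
  union of closed rectangles.\<close>

lemma closed_Compl_eq_UN_closed:
  fixes C :: "'x::metric_space set"
  assumes "closed C"
  shows "\<exists>D. (\<forall>n::nat. closed (D n)) \<and> - C = (\<Union>n. D n)"
\<comment> \<open>\<open>infdist\<close> to the empty set is 0 by convention, so the distance
  argument requires \<open>C\<close> to be nonempty.\<close>
proof (cases "C = {}")
  case False
  have "- C = (\<Union>n. {x. inverse (real (Suc n)) \<le> infdist x C})"
  proof (intro subset_antisym subsetI)
    fix x assume "x \<in> - C"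
    then have "0 < infdist x C"
      using assms False by (simp add: infdist_pos_not_in_closed)
    from reals_Archimedean[OF this] show "x \<in> (\<Union>n. {x. inverse (real (Suc n)) \<le> infdist x C})"
      by (auto intro: less_imp_le)
  next
    fix x assume "x \<in> (\<Union>n. {x. inverse (real (Suc n)) \<le> infdist x C})"
    then obtain n where n: "inverse (real (Suc n)) \<le> infdist x C" by auto
    show "x \<in> - C"
    proof
      assume "x \<in> C"
      then have "infdist x C = 0" by simp
      with n show False by (simp del: of_nat_Suc)
    qed
  qed
  moreover have "closed {x. inverse (real (Suc n)) \<le> infdist x C}" for n
    by (intro closed_Collect_le continuous_intros)
  ultimately show ?thesis by (intro exI[of _ "\<lambda>n. {x. inverse (real (Suc n)) \<le> infdist x C}"]) auto
qed (auto intro!: exI[of _ "\<lambda>_. UNIV"])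

lemma sets_pair_borel_subset_souslin:
  fixes M :: "'w measure"
  shows "sets (M \<Otimes>\<^sub>M (borel :: 'x::metric_space measure)) \<subseteq>
    souslin {A \<times> C |A C. A \<in> sets M \<and> closed C}" (is "_ \<subseteq> souslin ?P")
proof -
  let ?W = "space M \<times> (UNIV :: 'x set)"
  have "sets (M \<Otimes>\<^sub>M (borel :: 'x measure)) =
    sets (sigma (space M \<times> space (borel :: 'x measure)) {a \<times> b |a b. a \<in> sets M \<and> b \<in> Collect closed})"
    using sets.space_closed[of M]
    by (intro sets_pair_eq[where Ca="{space M}" and Cb="{UNIV}"])
      (auto simp: sets.sigma_sets_eq borel_eq_closed)
  also have "\<dots> = sigma_sets ?W ?P"
    using sets.sets_into_space by (subst sets_measure_of) fastforce+
  also have "\<dots> \<subseteq> souslin ?P"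
  proof (rule sigma_sets_subset_souslin)
    show P: "?P \<subseteq> Pow ?W" using sets.sets_into_space by fastforce
    then show "?P \<subseteq> Pow ?W" .
    show W: "?W \<in> ?P" by auto
    show "{} \<in> ?P" by auto
    fix R assume R: "R \<in> ?P"
    then show "R \<in> souslin ?P" by (rule souslin_basic)
    from R obtain A and C :: "'x set" where AC: "R = A \<times> C" "A \<in> sets M" "closed C" by auto
    from closed_Compl_eq_UN_closed[OF AC(3)] obtain D :: "nat \<Rightarrow> 'x set"
      where D: "\<And>n. closed (D n)" "- C = (\<Union>n. D n)" by auto
    have "(\<Union>n. space M \<times> D n) \<in> souslin ?P"
      using D by (intro souslin_UN[OF souslin_basic W]) auto
    moreover have "(space M - A) \<times> UNIV \<in> souslin ?P"
      using AC by (intro souslin_basic) auto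
    moreover have "(\<Union>n. space M \<times> D n) \<subseteq> ?W" "(space M - A) \<times> UNIV \<subseteq> ?W" by auto
    ultimately have "(\<Union>n. space M \<times> D n) \<union> (space M - A) \<times> UNIV \<in> souslin ?P"
      by (intro souslin_Un[OF _ _ W])
    also have "(\<Union>n. space M \<times> D n) = space M \<times> (- C)" using D(2) by blast
    also have "space M \<times> (- C) \<union> (space M - A) \<times> UNIV = ?W - R"
      using sets.sets_into_space[OF AC(2)] by (auto simp: AC(1))
    finally show "?W - R \<in> souslin ?P" .
  qed
  finally show ?thesis .
qed

text \<open>Along one branch the rectangles have a common point over \<open>w\<close> iff
  \<open>w\<close> lies in all base sides and the closed sides have a common point. By compactness
  the latter holds once all their finite intersections are nonempty, a condition on finite
  prefixes.\<close>

lemma fst_image_souslin: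
  fixes H :: "('w \<times> 'x::metric_space) set"
  assumes "compact (UNIV :: 'x set)"
    and "H \<in> souslin {A \<times> C |A (C :: 'x set). A \<in> \<A> \<and> closed C}" and "{} \<in> \<A>"
  shows "fst ` H \<in> souslin \<A>"
proof -
  from assms(2) obtain L where L: "\<And>n f. L n f \<in> {A \<times> C |A (C :: 'x set). A \<in> \<A> \<and> closed C}"
    "prefix_determined L" "H = (\<Union>f. \<Inter>n. L n f)" unfolding souslin_def by blast
  let ?rect = "\<lambda>R (A, C). R = A \<times> C \<and> A \<in> \<A> \<and> closed (C :: 'x set)"
  \<comment> \<open>The sides are chosen from the rectangle itself and not from \<open>n\<close> and
    \<open>f\<close>. Equal sets \<open>L n f\<close> thus get equal sides, and prefix determinacy
    is inherited.\<close>
  define a where "a R = fst (SOME AC. ?rect R AC)" for R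
  define c where "c R = snd (SOME AC. ?rect R AC)" for R
  have "?rect (L n f) (a (L n f), c (L n f))" for n f
  proof -
    from L(1)[of n f] have "\<exists>AC. ?rect (L n f) AC" by auto
    then have "?rect (L n f) (SOME AC. ?rect (L n f) AC)" by (rule someI_ex)
    then show ?thesis by (simp add: a_def c_def case_prod_beta)
  qed
  then have Leq: "L n f = a (L n f) \<times> c (L n f)" and aL: "a (L n f) \<in> \<A>" and cL: "closed (c (L n f))" for n f
    by simp_all
  have mem_L: "(w, x) \<in> L n f \<longleftrightarrow> w \<in> a (L n f) \<and> x \<in> c (L n f)" for w x n f
    using arg_cong[OF Leq[of n f], of "\<lambda>R. (w, x) \<in> R"] by simp
  define D where "D n f = (\<Inter>i\<le>n. c (L i f))" for n f
  \<comment> \<open>A branch whose closed sides already fail to meet at depth \<open>n\<close> is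
    cut off by the empty set.\<close>
  define B where "B n f = (if D n f = {} then {} else a (L n f))" for n f
  have L_cong: "L n f = L n g" if "\<And>i. i < n \<Longrightarrow> f i = g i" for n f g
    using prefix_determinedD[OF L(2)] that by blast
  show ?thesis
  proof (rule souslinI[of B])
    show "B n f \<in> \<A>" for n f using aL assms(3) by (simp add: B_def)
    show "prefix_determined B"
      unfolding prefix_determined_def
    proof (intro allI impI)
      fix n :: nat and f g :: "nat \<Rightarrow> nat" assume *: "\<forall>i<n. f i = g i"
      then have "L i f = L i g" if "i \<le> n" for i using that by (intro L_cong) auto
      then show "B n f = B n g" by (simp add: B_def D_def)
    qed
    have "fst ` (\<Inter>n. L n f) = (\<Inter>n. B n f)" for f
    proof (intro subset_antisym subsetI)
      fix w assume "w \<in> fst ` (\<Inter>n. L n f)"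
      then obtain x where "\<forall>n. (w, x) \<in> L n f" by auto
      then have wx: "w \<in> a (L n f)" "x \<in> c (L n f)" for n by (simp_all add: mem_L)
      then have "x \<in> D n f" for n by (auto simp: D_def)
      then have "D n f \<noteq> {}" for n by blast
      with wx show "w \<in> (\<Inter>n. B n f)" by (simp add: B_def)
    next
      fix w assume "w \<in> (\<Inter>n. B n f)"
      then have "w \<in> B n f" for n by blast
      then have w: "D n f \<noteq> {}" "w \<in> a (L n f)" for n
        by (metis B_def empty_iff)+
      have "(\<Inter>n. D n f) \<noteq> {}"
        by (rule compact_UNIV_decseq_INT_nonempty[OF assms(1)])
          (use cL w in \<open>auto simp: D_def decseq_def\<close>)
      then obtain x where "\<And>n. x \<in> c (L n f)" by (auto simp: D_def)
      with w have "(w, x) \<in> L n f" for n by (simp add: mem_L)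
      then show "w \<in> fst ` (\<Inter>n. L n f)" by force
    qed
    then show "fst ` H = (\<Union>f. \<Inter>n. B n f)" by (simp add: L(3) image_UN)
  qed
qed

lemma (in complete_finite_measure) measurable_projection:
  assumes "compact (UNIV :: 'x::metric_space set)" and "H \<in> sets (M \<Otimes>\<^sub>M (borel :: 'x measure))"
  shows "fst ` H \<in> sets M"
proof -
  have "fst ` H \<in> souslin (sets M)"
    using assms sets_pair_borel_subset_souslin by (intro fst_image_souslin) auto
  then show ?thesis using souslin_sets by blast
qed

section \<open>The covering dimension through a countable basis\<close>

lemma compact_UNIV_countable_basis:
  assumes "compact (UNIV :: 'x::metric_space set)"
  shows "\<exists>\<B> :: 'x set set. countable \<B> \<and> topological_basis \<B>"
proof -
  have "\<forall>n. \<exists>k. finite k \<and> (UNIV :: 'x set) \<subseteq> (\<Union>x\<in>k. ball x (inverse (real (Suc n))))"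
    using assms unfolding compact_eq_totally_bounded by simp
  then obtain k :: "nat \<Rightarrow> 'x set" where k: "\<And>n. finite (k n)"
    "\<And>n. UNIV \<subseteq> (\<Union>x\<in>k n. ball x (inverse (real (Suc n))))" by metis
  let ?B = "\<Union>n. (\<lambda>x. ball x (inverse (real (Suc n)))) ` k n"
  have "countable ?B" using k(1) by (auto intro: countable_finite)
  moreover have "topological_basis ?B"
  proof (rule topological_basisI)
    show "open b" if "b \<in> ?B" for b using that by auto
    fix O' :: "'x set" and x assume O: "open O'" "x \<in> O'"
    then obtain e where e: "e > 0" "ball x e \<subseteq> O'" by (meson openE)
    \<comment> \<open>A ball of radius below \<open>e / 2\<close> that contains \<open>x\<close>
      lies in \<open>ball x e\<close>.\<close>
    then obtain n where n: "inverse (real (Suc n)) < e / 2"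
      using reals_Archimedean half_gt_zero by blast
    obtain y where y: "y \<in> k n" "x \<in> ball y (inverse (real (Suc n)))" using k(2)[of n] by blast
    have "ball y (inverse (real (Suc n))) \<subseteq> ball x e"
    proof
      fix z assume "z \<in> ball y (inverse (real (Suc n)))"
      then show "z \<in> ball x e"
        using y(2) n dist_triangle[of x z y] by (simp add: dist_commute)
    qed
    with e y show "\<exists>b\<in>?B. x \<in> b \<and> b \<subseteq> O'" by blast
  qed
  ultimately show ?thesis by blast
qed

lemma sum_indicator_eq_card:
  "finite \<beta> \<Longrightarrow> (\<Sum>U\<in>\<beta>. indicator U x :: 'b::semiring_1) = of_nat (card {U \<in> \<beta>. x \<in> U})"
  by (simp add: indicator_def sum.If_cases Int_def)

lemma cover_ord_le_iff:
  assumes "finite \<beta>" and "K \<noteq> {}"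
  shows "cover_ord K \<beta> \<le> d \<longleftrightarrow> (\<forall>x\<in>K. int (card {U \<in> \<beta>. x \<in> U}) \<le> d + 1)"
proof -
  have bd: "bdd_above ((\<lambda>x. \<Sum>U\<in>\<beta>. indicator U x :: int) ` K)"
    by (rule bdd_aboveI2[where M = "\<Sum>U\<in>\<beta>. 1"]) (intro sum_mono indicator_le_1)
  have "cover_ord K \<beta> \<le> d \<longleftrightarrow> (SUP x\<in>K. \<Sum>U\<in>\<beta>. indicator U x) \<le> d + 1"
    by (auto simp: cover_ord_def)
  also have "\<dots> \<longleftrightarrow> (\<forall>x\<in>K. (\<Sum>U\<in>\<beta>. indicator U x) \<le> d + 1)"
    by (rule cSUP_le_iff[OF assms(2) bd])
  finally show ?thesis using assms(1) by (simp add: sum_indicator_eq_card)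
qed

text \<open>Replaces the minimum over all covers of \<open>K\<close>, which vary with
  \<open>K\<close>, by a search through a fixed family that is countable when \<open>\<B>\<close>
  is. What remains are conditions tested at the points of \<open>K\<close>.\<close>

lemma cover_dim_le_iff:
  fixes K :: "'x::topological_space set"
  assumes \<B>: "topological_basis \<B>" and K: "compact K" "K \<noteq> {}" and \<gamma>: "finite_open_cover K \<gamma>"
  shows "\<D> K \<gamma> \<le> d \<longleftrightarrow>
    (\<exists>\<U>. finite \<U> \<and> \<U> \<subseteq> Union ` {F. finite F \<and> F \<subseteq> \<B>} \<and> K \<subseteq> \<Union>\<U> \<and>
      (\<forall>G\<in>\<U>. \<exists>U\<in>\<gamma>. K \<inter> G \<subseteq> U) \<and> (\<forall>x\<in>K. int (card {G \<in> \<U>. x \<in> G}) \<le> d + 1))"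
    (is "_ \<longleftrightarrow> (\<exists>\<U>. ?Q \<U>)")
proof
  assume "\<D> K \<gamma> \<le> d"
  then obtain \<beta> where \<beta>: "finite_open_cover K \<beta>" "\<beta> refines \<gamma>" "cover_ord K \<beta> \<le> d"
    using cover_dim_attained[OF \<gamma> K(2)] by auto
  then have fin: "finite \<beta>" and un: "\<Union>\<beta> = K" by (auto simp: finite_open_cover_def)
  define \<B>' where "\<B>' = {b \<in> \<B>. \<exists>V\<in>\<beta>. K \<inter> b \<subseteq> V}"
  have "K \<subseteq> \<Union>\<B>'"
  proof
    fix x assume x: "x \<in> K"
    then obtain V where V: "V \<in> \<beta>" "x \<in> V" using un by auto
    then obtain O' where O': "open O'" "V = K \<inter> O'"
      using \<beta>(1) by (auto simp: finite_open_cover_def openin_open)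
    then obtain b where "b \<in> \<B>" "x \<in> b" "b \<subseteq> O'"
      using \<B> V by (meson IntD2 topological_basisE)
    with V(1) O'(2) have "b \<in> \<B>'" by (auto simp: \<B>'_def intro!: bexI[of _ V])
    with \<open>x \<in> b\<close> show "x \<in> \<Union>\<B>'" by blast
  qed
  then obtain F where F: "F \<subseteq> \<B>'" "finite F" "K \<subseteq> \<Union>F"
    using compactE[OF K(1), of \<B>'] topological_basis_open[OF \<B>] by (auto simp: \<B>'_def)
  \<comment> \<open>A basic set \<open>b\<close> may enter several \<open>g V\<close>. This does not
    raise the order, since on \<open>K\<close> each \<open>g V\<close> stays inside
    \<open>V\<close>.\<close>
  define g where "g V = \<Union>{b \<in> F. K \<inter> b \<subseteq> V}" for V
  have gV: "K \<inter> g V \<subseteq> V" for V by (auto simp: g_def)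
  have "?Q (g ` \<beta>)"
  proof (intro conjI ballI)
    show "finite (g ` \<beta>)" using fin by simp
    show "g ` \<beta> \<subseteq> Union ` {F. finite F \<and> F \<subseteq> \<B>}"
    proof
      fix G assume "G \<in> g ` \<beta>"
      then obtain V where "G = \<Union>{b \<in> F. K \<inter> b \<subseteq> V}" by (auto simp: g_def)
      moreover have "{b \<in> F. K \<inter> b \<subseteq> V} \<in> {F. finite F \<and> F \<subseteq> \<B>}"
        using F by (auto simp: \<B>'_def)
      ultimately show "G \<in> Union ` {F. finite F \<and> F \<subseteq> \<B>}" by blast
    qed
    show "K \<subseteq> \<Union>(g ` \<beta>)"
    proof
      fix x assume "x \<in> K"
      then obtain b where b: "b \<in> F" "x \<in> b" using F(3) by blast
      then obtain V where V: "V \<in> \<beta>" "K \<inter> b \<subseteq> V" using F(1) unfolding \<B>'_def by blast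
      with b have "x \<in> g V" unfolding g_def by blast
      with V(1) show "x \<in> \<Union>(g ` \<beta>)" by blast
    qed
  next
    fix G assume "G \<in> g ` \<beta>"
    then obtain V where V: "V \<in> \<beta>" "G = g V" by blast
    then obtain U where "U \<in> \<gamma>" "V \<subseteq> U" using \<beta>(2) unfolding refines_def by blast
    with gV V(2) show "\<exists>U\<in>\<gamma>. K \<inter> G \<subseteq> U" by blast
  next
    fix x assume x: "x \<in> K"
    have "x \<in> V" if "x \<in> g V" for V using gV[of V] x that by blast
    then have "{G \<in> g ` \<beta>. x \<in> G} \<subseteq> g ` {V \<in> \<beta>. x \<in> V}" by auto
    then have "card {G \<in> g ` \<beta>. x \<in> G} \<le> card (g ` {V \<in> \<beta>. x \<in> V})"
      using fin by (intro card_mono finite_imageI) simp_all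
    also have "\<dots> \<le> card {V \<in> \<beta>. x \<in> V}"
      using fin by (intro card_image_le) auto
    also have "int \<dots> \<le> d + 1" using \<beta>(3) cover_ord_le_iff[OF fin K(2)] x by blast
    finally show "int (card {G \<in> g ` \<beta>. x \<in> G}) \<le> d + 1" by simp
  qed
  then show "\<exists>\<U>. ?Q \<U>" by blast
next
  assume "\<exists>\<U>. ?Q \<U>"
  then obtain \<U> where \<U>: "finite \<U>" "\<U> \<subseteq> Union ` {F. finite F \<and> F \<subseteq> \<B>}" "K \<subseteq> \<Union>\<U>"
    "\<forall>G\<in>\<U>. \<exists>U\<in>\<gamma>. K \<inter> G \<subseteq> U" "\<forall>x\<in>K. int (card {G \<in> \<U>. x \<in> G}) \<le> d + 1" by blast
  let ?\<beta> = "(\<inter>) K ` \<U>"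
  have "open G" if "G \<in> \<U>" for G
    using that \<U>(2) topological_basis_open[OF \<B>] by blast
  then have foc: "finite_open_cover K ?\<beta>"
    using \<U>(1,3) by (auto simp: finite_open_cover_def)
  have ref: "?\<beta> refines \<gamma>" using \<U>(4) by (auto simp: refines_def)
  have "\<D> K \<gamma> \<le> cover_ord K ?\<beta>" by (rule cover_dim_le[OF foc ref K(2)])
  also have "\<dots> \<le> d"
  proof (subst cover_ord_le_iff)
    show "\<forall>x\<in>K. int (card {U \<in> ?\<beta>. x \<in> U}) \<le> d + 1"
    proof
      fix x assume x: "x \<in> K"
      \<comment> \<open>Distinct members of \<open>\<U>\<close> may have the same trace on
        \<open>K\<close>; passing to traces can only lower the multiplicity.\<close>
      have "{U \<in> ?\<beta>. x \<in> U} \<subseteq> (\<inter>) K ` {G \<in> \<U>. x \<in> G}" by blast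
      then have "card {U \<in> ?\<beta>. x \<in> U} \<le> card ((\<inter>) K ` {G \<in> \<U>. x \<in> G})"
        using \<U>(1) by (intro card_mono finite_imageI) simp_all
      also have "\<dots> \<le> card {G \<in> \<U>. x \<in> G}"
        using \<U>(1) by (intro card_image_le) auto
      also have "int \<dots> \<le> d + 1" using \<U>(5) x by blast
      finally show "int (card {U \<in> ?\<beta>. x \<in> U}) \<le> d + 1" by simp
    qed
  qed (use \<U>(1) K in auto)
  finally show "\<D> K \<gamma> \<le> d" .
qed

section \<open>Measurability over the base\<close>

context continuous_bundle_rds
begin

sublocale complete_finite_measure M ..

text \<open>The skew product sends \<open>(\<omega>, x)\<close> to the shifted base point and the
  iterate of \<open>x\<close>. It is measurable by induction, and composing it with the fiber map
  gives the next iterate.\<close>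

lemma measurable_iterate:
  "(\<lambda>p. iterate \<theta> T i (fst p) (snd p)) \<in> restrict_space (M \<Otimes>\<^sub>M borel) E \<rightarrow>\<^sub>M borel"
proof (induction i)
  case 0
  show ?case by (auto intro!: measurable_restrict_space1)
next
  case (Suc i)
  let ?R = "restrict_space (M \<Otimes>\<^sub>M borel) E"
  let ?g = "\<lambda>p. ((\<theta> ^^ i) (fst p), iterate \<theta> T i (fst p) (snd p))"
  have \<theta>: "(\<theta> ^^ i) \<in> M \<rightarrow>\<^sub>M M"
    using base_measurable by (rule measurable_compose_n)
  have "(\<lambda>p. (\<theta> ^^ i) (fst p)) \<in> ?R \<rightarrow>\<^sub>M M"
    using \<theta> by (intro measurable_restrict_space1 measurable_fst'')
  then have "?g \<in> ?R \<rightarrow>\<^sub>M M \<Otimes>\<^sub>M borel"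
    using Suc by (rule measurable_Pair)
  \<comment> \<open>The fiber map is measurable only on \<open>E\<close>, so the skew product has to
    stay in \<open>E\<close>.\<close>
  moreover have "?g \<in> space ?R \<rightarrow> E"
    using iterate_fiber[of _ _ i]
    by (auto simp: space_restrict_space space_pair_measure fiber_def)
  ultimately have "?g \<in> ?R \<rightarrow>\<^sub>M ?R" by (intro measurable_restrict_space2)
  from measurable_compose[OF this map_measurable] show ?case
    by (simp add: case_prod_beta)
qed

text \<open>The exceptional \<open>\<omega>\<close> form the projection of the measurable set of
  points of \<open>E\<close> where \<open>P\<close> fails. This handles a quantifier over a possibly
  uncountable fiber.\<close>

lemma sets_Collect_fiber_all:
  assumes "Measurable.pred (restrict_space (M \<Otimes>\<^sub>M borel) E) (\<lambda>p. P (fst p) (snd p))"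
  shows "{\<omega> \<in> space M. \<forall>x\<in>fiber E \<omega>. P \<omega> x} \<in> sets M"
proof -
  let ?R = "restrict_space (M \<Otimes>\<^sub>M borel) E" and ?H = "{p \<in> E. \<not> P (fst p) (snd p)}"
  have sub: "E \<subseteq> space M \<times> UNIV"
    using sets.sets_into_space[OF bundle_measurable] by (simp add: space_pair_measure)
  then have E: "space ?R = E" by (auto simp: space_restrict_space space_pair_measure)
  have "{p \<in> space ?R. \<not> P (fst p) (snd p)} \<in> sets ?R"
    using assms by measurable
  then have "?H \<in> sets (M \<Otimes>\<^sub>M borel)"
    unfolding E using bundle_measurable by (subst (asm) sets_restrict_space_iff) auto
  from measurable_projection[OF compact_X this] have "fst ` ?H \<in> sets M" .
  moreover have "{\<omega> \<in> space M. \<forall>x\<in>fiber E \<omega>. P \<omega> x} = space M - fst ` ?H"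
    using sub by (force simp: fiber_def)
  ultimately show ?thesis by auto
qed

text \<open>The members of the joined cover move with \<open>\<omega>\<close>, but their index set
  \<open>PiE {..<n} (\<lambda>_. \<alpha>)\<close> is fixed and finite. Refinement becomes a finite
  disjunction of conditions on all points of the fiber.\<close>

lemma ex_join_cover_iff:
  assumes "n \<ge> 1" and "\<omega> \<in> space M"
  shows "(\<exists>U\<in>join_cover \<theta> E T \<alpha> n \<omega>. fiber E \<omega> \<inter> G \<subseteq> U) \<longleftrightarrow>
    (\<exists>A\<in>PiE {..<n} (\<lambda>_. \<alpha>). \<forall>x\<in>fiber E \<omega>. x \<in> G \<longrightarrow> (\<forall>i<n. iterate \<theta> T i \<omega> x \<in> A i))"
    (is "?l \<longleftrightarrow> ?r")
proof
  assume ?l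
  then obtain A where "\<forall>i<n. A i \<in> \<alpha>"
    "fiber E \<omega> \<inter> G \<subseteq> (\<Inter>i<n. {x \<in> fiber E \<omega>. iterate \<theta> T i \<omega> x \<in> A i \<inter> fiber E ((\<theta> ^^ i) \<omega>)})"
    unfolding join_cover_def by blast
  then show ?r by (intro bexI[of _ "restrict A {..<n}"]) auto
next
  assume ?r
  then obtain A where A: "A \<in> PiE {..<n} (\<lambda>_. \<alpha>)"
    "\<forall>x\<in>fiber E \<omega>. x \<in> G \<longrightarrow> (\<forall>i<n. iterate \<theta> T i \<omega> x \<in> A i)" by blast
  have "fiber E \<omega> \<inter> G \<subseteq>
      (\<Inter>i<n. {x \<in> fiber E \<omega>. iterate \<theta> T i \<omega> x \<in> A i \<inter> fiber E ((\<theta> ^^ i) \<omega>)})"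
    using A(2) iterate_fiber[OF assms(2)] by auto
  moreover have "\<forall>i<n. A i \<in> \<alpha>" using A(1) by auto
  ultimately show ?l unfolding join_cover_def by blast
qed

lemma measurable_cover_dim_join_cover:
  assumes n: "n \<ge> 1" and \<alpha>: "finite_open_cover UNIV \<alpha>"
  shows "(\<lambda>\<omega>. \<D> (fiber E \<omega>) (join_cover \<theta> E T \<alpha> n \<omega>)) \<in> M \<rightarrow>\<^sub>M count_space UNIV"
proof -
  obtain \<B> :: "'x set set" where \<B>: "countable \<B>" "topological_basis \<B>"
    using compact_UNIV_countable_basis[OF compact_X] by blast
  define \<G> where "\<G> = Union ` {F. finite F \<and> F \<subseteq> \<B>}"
  have "countable \<G>" unfolding \<G>_def using \<B>(1) by (intro countable_image countable_Collect_finite_subset)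
  then have cnt: "countable {\<U>. finite \<U> \<and> \<U> \<subseteq> \<G>}" by (rule countable_Collect_finite_subset)
  have G_open: "open G" if "G \<in> \<G>" for G
    using that topological_basis_open[OF \<B>(2)] by (auto simp: \<G>_def)
  let ?S = "PiE {..<n} (\<lambda>_. \<alpha>)" and ?R = "restrict_space (M \<Otimes>\<^sub>M borel) E"
  have finS: "finite ?S" using \<alpha> by (intro finite_PiE) (auto simp: finite_open_cover_def)
  let ?D = "\<lambda>\<omega>. \<D> (fiber E \<omega>) (join_cover \<theta> E T \<alpha> n \<omega>)"
  have snd_R: "snd \<in> ?R \<rightarrow>\<^sub>M (borel :: 'x measure)"
    by (intro measurable_restrict_space1) simp
  have snd_pred: "Measurable.pred ?R (\<lambda>p. snd p \<in> B)" if "B \<in> sets borel" for B :: "'x set"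
    using that snd_R by (rule pred_sets2)
  have le_sets: "{\<omega> \<in> space M. ?D \<omega> \<le> d} \<in> sets M" for d
  proof -
    define Q where "Q \<U> = {\<omega> \<in> space M. fiber E \<omega> \<subseteq> \<Union>\<U> \<and>
      (\<forall>G\<in>\<U>. \<exists>A\<in>?S. \<forall>x\<in>fiber E \<omega>. x \<in> G \<longrightarrow> (\<forall>i<n. iterate \<theta> T i \<omega> x \<in> A i)) \<and>
      (\<forall>x\<in>fiber E \<omega>. int (card {G \<in> \<U>. x \<in> G}) \<le> d + 1)}" for \<U>
    have Q_sets: "Q \<U> \<in> sets M" if \<U>: "finite \<U>" "\<U> \<subseteq> \<G>" for \<U>
      unfolding Q_def
    proof (intro sets.sets_Collect_conj)
      have [measurable]: "G \<in> sets borel" if "G \<in> \<U>" for G using G_open \<U> that by auto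
      have "\<Union>\<U> \<in> sets borel" using \<U> by auto
      from snd_pred[OF this] show "{\<omega> \<in> space M. fiber E \<omega> \<subseteq> \<Union>\<U>} \<in> sets M"
        unfolding subset_eq by (rule sets_Collect_fiber_all)
      \<comment> \<open>The multiplicity is rewritten as a real sum of indicators of open sets,
        which is a Borel function.\<close>
      have "{x. (\<Sum>G\<in>\<U>. indicator G x :: real) \<le> real_of_int (d + 1)} \<in> sets borel"
        by measurable
      also have "{x. (\<Sum>G\<in>\<U>. indicator G x :: real) \<le> real_of_int (d + 1)} =
          {x. int (card {G \<in> \<U>. x \<in> G}) \<le> d + 1}"
        unfolding sum_indicator_eq_card[OF \<U>(1)] by (intro Collect_cong) linarith
      finally have "Measurable.pred ?R (\<lambda>p. snd p \<in> {x. int (card {G \<in> \<U>. x \<in> G}) \<le> d + 1})"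
        by (rule snd_pred)
      then show "{\<omega> \<in> space M. \<forall>x\<in>fiber E \<omega>. int (card {G \<in> \<U>. x \<in> G}) \<le> d + 1} \<in> sets M"
        by (intro sets_Collect_fiber_all) simp
      have "{\<omega> \<in> space M. \<forall>x\<in>fiber E \<omega>. x \<in> G \<longrightarrow> (\<forall>i<n. iterate \<theta> T i \<omega> x \<in> A i)} \<in> sets M"
        if "G \<in> \<U>" "A \<in> ?S" for G A
      proof (rule sets_Collect_fiber_all)
        have A[measurable]: "A i \<in> sets borel" if "i < n" for i
          using PiE_mem[OF \<open>A \<in> ?S\<close>, of i] \<alpha> that by (auto simp: finite_open_cover_def)
        have "Measurable.pred ?R (\<lambda>p. iterate \<theta> T i (fst p) (snd p) \<in> A i)" if "i < n" for i
          using A[OF that] measurable_iterate by (rule pred_sets2)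
        then show "Measurable.pred ?R (\<lambda>p. snd p \<in> G \<longrightarrow> (\<forall>i<n. iterate \<theta> T i (fst p) (snd p) \<in> A i))"
          using snd_pred[of G] \<open>G \<in> \<U>\<close> by (intro pred_intros_logic(4) pred_intros_countable(1) pred_intros_imp') auto
      qed
      then show "{\<omega> \<in> space M. \<forall>G\<in>\<U>. \<exists>A\<in>?S. \<forall>x\<in>fiber E \<omega>. x \<in> G \<longrightarrow> (\<forall>i<n. iterate \<theta> T i \<omega> x \<in> A i)} \<in> sets M"
        using \<U>(1) finS by (intro sets.sets_Collect_finite_All sets.sets_Collect_finite_Ex) auto
    qed
    \<comment> \<open>The characterization through \<open>\<U>\<close> is available where the
      iterates are continuous, hence almost everywhere. Completeness then passes measurability from
      the countable union to the sublevel set.\<close>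
    have "AE \<omega> in M. \<omega> \<in> (\<Union>\<U>\<in>{\<U>. finite \<U> \<and> \<U> \<subseteq> \<G>}. Q \<U>) \<longleftrightarrow> \<omega> \<in> {\<omega> \<in> space M. ?D \<omega> \<le> d}"
      using AE_continuous_iterate AE_space
    proof eventually_elim
      case (elim \<omega>)
      then have foc: "finite_open_cover (fiber E \<omega>) (join_cover \<theta> E T \<alpha> n \<omega>)"
        by (intro finite_open_cover_join_cover \<alpha> n) auto
      have "?D \<omega> \<le> d \<longleftrightarrow> (\<exists>\<U>. finite \<U> \<and> \<U> \<subseteq> \<G> \<and> fiber E \<omega> \<subseteq> \<Union>\<U> \<and>
        (\<forall>G\<in>\<U>. \<exists>A\<in>?S. \<forall>x\<in>fiber E \<omega>. x \<in> G \<longrightarrow> (\<forall>i<n. iterate \<theta> T i \<omega> x \<in> A i)) \<and>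
        (\<forall>x\<in>fiber E \<omega>. int (card {G \<in> \<U>. x \<in> G}) \<le> d + 1))"
        unfolding cover_dim_le_iff[OF \<B>(2) fiber_compact[OF elim(2)] fiber_nonempty[OF elim(2)] foc]
          \<G>_def ex_join_cover_iff[OF n elim(2)] ..
      then show ?case
        using elim(2) by (simp add: Q_def)
    qed
    moreover have "(\<Union>\<U>\<in>{\<U>. finite \<U> \<and> \<U> \<subseteq> \<G>}. Q \<U>) \<in> sets M"
      using cnt Q_sets by (intro sets.countable_UN'') auto
    ultimately show ?thesis by (rule in_sets_AE) auto
  qed
  show ?thesis
    unfolding measurable_count_space_eq2_countable
  proof (intro conjI ballI)
    fix d :: int
    \<comment> \<open>The values are integers, so the countably many level sets decide
      measurability, and each is a difference of two sublevel sets.\<close>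
    have eq: "?D -` {d} \<inter> space M = {\<omega> \<in> space M. ?D \<omega> \<le> d} - {\<omega> \<in> space M. ?D \<omega> \<le> d - 1}" by auto
    show "?D -` {d} \<inter> space M \<in> sets M"
      unfolding eq by (intro sets.Diff le_sets)
  qed auto
qed

end

theorem theorem2p1:
  fixes M :: "'w measure"
    and \<theta> :: "'w \<Rightarrow> 'w"
    and E :: "('w \<times> 'x::metric_space) set"
    and T :: "'w \<Rightarrow> 'x \<Rightarrow> 'x"
    and n :: nat
    and \<alpha> :: "'x set set"
  assumes "continuous_bundle_rds M \<theta> E T"
    and "n \<ge> 1"
    and "finite_open_cover UNIV \<alpha>"
  shows "(\<lambda>\<omega>. \<D> (fiber E \<omega>) (join_cover \<theta> E T \<alpha> n \<omega>)) \<in> M \<rightarrow>\<^sub>M count_space UNIV"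
proof -
  interpret continuous_bundle_rds M \<theta> E T by (rule assms(1))
  show ?thesis using assms(2,3) by (rule measurable_cover_dim_join_cover)
qed

end
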